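(* Let $(X,\rho)$ be a proper locally compact metric space and let $\mathscr H,\mathscr K$ be Banach $X$-modules. If $S\in\mathcal B(\mathscr H,\mathscr K)$ and if $[S,\theta(Q)]$ is bounded for each positive Lipschitz function $\theta$ on $X$, then $S$ is decay preserving.
   Context: A locally compact metric space $(X,\rho)$ is proper if $\lim_{y\to\infty}\rho(x,y)=\infty$ for some (hence all) $x\in X$; equivalently, $X$ is not compact but its closed balls are compact. A Banach $X$-module is a Banach space $\mathscr H$ together with a continuous morphism (linear multiplicative map) $Q:C_0(X)\to\mathcal B(\mathscr H)$, written $\varphi(Q)\equiv Q(\varphi)$, such that the linear span of the vectors $\varphi(Q)u$ ($\varphi\in C_0(X)$, $u\in\mathscr H$) is dense in $\mathscr H$. Its multiplier algebra $\mathcal M(\mathscr H)$ is the norm closure in $\mathcal B(\mathscr H)$ of $\{\varphi(Q):\varphi\in C_0(X)\}$. For $\theta\in C(X)$, not necessarily bounded, $[S,\theta(Q)]$ is said to be bounded if there is a constant $C$ such that $\|\xi(Q)S(\theta\eta)(Q)-(\xi\theta)(Q)S\eta(Q)\|\le C\sup|\xi|\sup|\eta|$ for all $\xi,\eta\in C_{\rm c}(X)$. $\mathcal B_0^{\,l}(\mathscr H,\mathscr K)$ (resp. $\mathcal B_0^{\,r}(\mathscr H,\mathscr K)$) is the norm-closed linear span of the operators $NT$ with $N\in\mathcal M(\mathscr K)$ (resp. $TM$ with $M\in\mathcal M(\mathscr H)$), $T\in\mathcal B(\mathscr H,\mathscr K)$. $S$ is decay preserving if $SM\in\mathcal B_0^{\,l}(\mathscr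 H,\mathscr K)$ for every $M\in\mathcal M(\mathscr H)$ and $NS\in\mathcal B_0^{\,r}(\mathscr H,\mathscr K)$ for every $N\in\mathcal M(\mathscr K)$. *)

theory Defs
  imports "HOL-Analysis.Analysis"
begin

section \<open>Complex Banach spaces\<close>

text \<open>The library has only real Banach spaces; the complex structure is added on top.\<close>

class complex_banach = banach +
  fixes scaleC :: "complex \<Rightarrow> 'a \<Rightarrow> 'a" (infixr \<open>*\<^sub>C\<close> 75)
  assumes scaleC_add_right: "c *\<^sub>C (x + y) = c *\<^sub>C x + c *\<^sub>C y"
    and scaleC_add_left: "(c + d) *\<^sub>C x = c *\<^sub>C x + d *\<^sub>C x"
    and scaleC_scaleC: "c *\<^sub>C d *\<^sub>C x = (c * d) *\<^sub>C x"
    and scaleC_of_real: "complex_of_real r *\<^sub>C x = r *\<^sub>R x"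
    and norm_scaleC: "norm (c *\<^sub>C x) = cmod c * norm x"

global_interpretation complex_vector:
  vector_space "scaleC :: complex \<Rightarrow> 'a \<Rightarrow> 'a::complex_banach"
  defines cspan = "complex_vector.span :: 'a set \<Rightarrow> 'a set"
proof
  show "1 *\<^sub>C x = x" for x :: 'a
    using scaleC_of_real[of 1 x] by simp
qed (simp_all add: scaleC_add_right scaleC_add_left scaleC_scaleC)

text \<open>
  The real-linear bounded operators into a complex Banach space form a complex Banach space
  under pointwise scalar multiplication; the complex-linear ones are a closed subspace of it.
\<close>

instantiation blinfun :: (real_normed_vector, complex_banach) complex_banach
begin

lift_definition scaleC_blinfun :: "complex \<Rightarrow> ('a \<Rightarrow>\<^sub>L 'b) \<Rightarrow> ('a \<Rightarrow>\<^sub>L 'b)"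
  is "\<lambda>c f x. c *\<^sub>C f x"
proof -
  fix c :: complex and f :: "'a \<Rightarrow> 'b"
  assume f: "bounded_linear f"
  then interpret f: bounded_linear f .
  show "bounded_linear (\<lambda>x. c *\<^sub>C f x)"
  proof (rule bounded_linear_intro)
    show "c *\<^sub>C f (x + y) = c *\<^sub>C f x + c *\<^sub>C f y" for x y
      by (simp add: f.add scaleC_add_right)
    show "c *\<^sub>C f (r *\<^sub>R x) = r *\<^sub>R c *\<^sub>C f x" for r x
      by (simp add: f.scaleR scaleC_of_real[symmetric] scaleC_scaleC mult.commute)
    show "norm (c *\<^sub>C f x) \<le> norm x * (cmod c * onorm f)" for x
      using mult_left_mono[OF onorm[OF f, of x], of "cmod c"]
      by (simp add: norm_scaleC mult_ac)
  qed
qed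

instance
proof
  fix c d :: complex and x y :: "'a \<Rightarrow>\<^sub>L 'b" and r :: real
  show "c *\<^sub>C (x + y) = c *\<^sub>C x + c *\<^sub>C y"
    by transfer (simp add: scaleC_add_right)
  show "(c + d) *\<^sub>C x = c *\<^sub>C x + d *\<^sub>C x"
    by transfer (simp add: scaleC_add_left)
  show "c *\<^sub>C d *\<^sub>C x = (c * d) *\<^sub>C x"
    by transfer (simp add: scaleC_scaleC)
  show "complex_of_real r *\<^sub>C x = r *\<^sub>R x"
    by transfer (simp add: scaleC_of_real)
  have le: "norm (c *\<^sub>C x) \<le> cmod c * norm x" for c :: complex and x :: "'a \<Rightarrow>\<^sub>L 'b"
  proof (rule norm_blinfun_bound)
    fix v
    have "norm (blinfun_apply (c *\<^sub>C x) v) = cmod c * norm (blinfun_apply x v)"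
      by (simp add: scaleC_blinfun.rep_eq norm_scaleC)
    also have "\<dots> \<le> cmod c * (norm x * norm v)"
      by (intro mult_left_mono norm_blinfun) simp
    finally show "norm (blinfun_apply (c *\<^sub>C x) v) \<le> cmod c * norm x * norm v"
      by (simp add: mult.assoc)
  qed simp
  show "norm (c *\<^sub>C x) = cmod c * norm x"
  proof (cases "c = 0")
    case True
    then show ?thesis using le[of 0 x] by simp
  next
    case False
    have "inverse c *\<^sub>C c *\<^sub>C x = x"
      using False by transfer
        (simp add: scaleC_scaleC complex_vector.scale_one)
    then have "norm x \<le> cmod (inverse c) * norm (c *\<^sub>C x)"
      using le[of "inverse c" "c *\<^sub>C x"] by simp
    then have "cmod c * norm x \<le> norm (c *\<^sub>C x)"
      using False by (simp add: norm_divide field_simps)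
    with le[of c x] show ?thesis by simp
  qed
qed

end

text \<open>The space of bounded complex-linear operators.\<close>

definition bounded_ops :: "('h::complex_banach \<Rightarrow>\<^sub>L 'k::complex_banach) set" where
  "bounded_ops = {T. \<forall>c u. blinfun_apply T (c *\<^sub>C u) = c *\<^sub>C blinfun_apply T u}"


section \<open>Function spaces and proper metric spaces\<close>

text \<open>The trace on the space of the neighbourhoods of infinity of the one-point compactification.\<close>

definition at_infty :: "'x::topological_space filter" where
  "at_infty = (INF K\<in>{K. compact K}. principal (- K))"

lemma eventually_at_infty:
  "eventually P at_infty \<longleftrightarrow> (\<exists>K. compact K \<and> (\<forall>x. x \<notin> K \<longrightarrow> P x))"
proof -
  have "eventually P at_infty \<longleftrightarrow> (\<exists>K\<in>{K. compact K}. eventually P (principal (- K)))"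
    unfolding at_infty_def
  proof (rule eventually_INF_base)
    show "{K :: 'a set. compact K} \<noteq> {}"
      using compact_empty by blast
    fix K L :: "'a set"
    assume "K \<in> {K. compact K}" "L \<in> {K. compact K}"
    then have "compact (K \<union> L)" by (simp add: compact_Un)
    then show "\<exists>M\<in>{K. compact K}. principal (- M) \<le> inf (principal (- K)) (principal (- L))"
      by (intro bexI[of _ "K \<union> L"]) auto
  qed
  then show ?thesis by (auto simp: eventually_principal)
qed

definition C0 :: "('x::topological_space \<Rightarrow> complex) set" where
  "C0 = {f. continuous_on UNIV f \<and> (f \<longlongrightarrow> 0) at_infty}"

definition Cc :: "('x::topological_space \<Rightarrow> complex) set" where
  "Cc = {f. continuous_on UNIV f \<and> compact (closure {x. f x \<noteq> 0})}"

text \<open>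
  Non-compactness has to be required separately: in a compact space \<^term>\<open>at_infty\<close> is the
  trivial filter and the limit condition holds vacuously.
\<close>

definition proper_metric_space :: "'x::metric_space itself \<Rightarrow> bool" where
  "proper_metric_space _ \<longleftrightarrow>
     locally compact (UNIV :: 'x set) \<and> \<not> compact (UNIV :: 'x set) \<and>
     (\<exists>x::'x. filterlim (\<lambda>y. dist x y) at_top at_infty)"

lemma proper_metric_space_iff:
  "proper_metric_space TYPE('x::metric_space) \<longleftrightarrow>
     \<not> compact (UNIV :: 'x set) \<and> (\<forall>(x::'x) r. compact (cball x r))"
proof (intro iffI conjI allI)
  assume *: "proper_metric_space TYPE('x)"
  then show "\<not> compact (UNIV :: 'x set)" by (simp add: proper_metric_space_def)
  fix x :: 'x and r
  from * obtain z :: 'x where "filterlim (\<lambda>y. dist z y) at_top at_infty"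
    by (auto simp: proper_metric_space_def)
  then have "eventually (\<lambda>y. dist z y > r + dist z x) at_infty"
    by (simp add: filterlim_at_top_dense)
  then obtain K where K: "compact K" "\<And>y. y \<notin> K \<Longrightarrow> dist z y > r + dist z x"
    by (auto simp: eventually_at_infty)
  have "cball x r \<subseteq> K"
  proof
    fix y assume "y \<in> cball x r"
    then have "dist z y \<le> r + dist z x"
      using dist_triangle[of z y x] by simp
    then show "y \<in> K" using K(2)[of y] by force
  qed
  then have "cball x r = K \<inter> cball x r" by blast
  moreover have "compact (K \<inter> cball x r)" using K(1) by (rule compact_Int_closed) simp
  ultimately show "compact (cball x r)" by simp
next
  assume *: "\<not> compact (UNIV :: 'x set) \<and> (\<forall>(x::'x) r. compact (cball x r))"
  have "locally compact (UNIV :: 'x set)"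
    unfolding locally_def
  proof (intro allI impI, elim conjE)
    fix w :: "'x set" and x
    assume w: "openin (top_of_set UNIV) w" "x \<in> w"
    then obtain e where e: "e > 0" "cball x e \<subseteq> w"
      by (auto simp: open_contains_cball)
    show "\<exists>u v. openin (top_of_set UNIV) u \<and> compact v \<and> x \<in> u \<and> u \<subseteq> v \<and> v \<subseteq> w"
      using e * by (intro exI[of _ "ball x e"] exI[of _ "cball x e"]) auto
  qed
  moreover have "filterlim (\<lambda>y. dist x y) at_top at_infty" for x :: 'x
    unfolding filterlim_at_top_dense
  proof
    fix r
    show "eventually (\<lambda>y. r < dist x y) at_infty"
      unfolding eventually_at_infty
      using * by (intro exI[of _ "cball x r"]) auto
  qed
  ultimately show "proper_metric_space TYPE('x)"
    using * by (auto simp: proper_metric_space_def)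
qed


section \<open>Banach modules\<close>

text \<open>
  The morphism is given on functions; only its values on \<^term>\<open>C0\<close> matter. Its continuity is
  with respect to the supremum norm, which is the norm of the type of bounded continuous functions.
\<close>

definition banach_module ::
    "(('x::topological_space \<Rightarrow> complex) \<Rightarrow> ('h::complex_banach \<Rightarrow>\<^sub>L 'h)) \<Rightarrow> bool" where
  "banach_module Q \<longleftrightarrow>
     (\<forall>\<phi>\<in>C0. Q \<phi> \<in> bounded_ops) \<and>
     (\<forall>\<phi>\<in>C0. \<forall>\<psi>\<in>C0. Q (\<lambda>x. \<phi> x + \<psi> x) = Q \<phi> + Q \<psi>) \<and>
     (\<forall>c. \<forall>\<phi>\<in>C0. Q (\<lambda>x. c * \<phi> x) = c *\<^sub>C Q \<phi>) \<and>
     (\<forall>\<phi>\<in>C0. \<forall>\<psi>\<in>C0. Q (\<lambda>x. \<phi> x * \<psi> x) = Q \<phi> o\<^sub>L Q \<psi>) \<and>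
     continuous_on {\<phi> :: 'x \<Rightarrow>\<^sub>C complex. apply_bcontfun \<phi> \<in> C0} (\<lambda>\<phi>. Q (apply_bcontfun \<phi>)) \<and>
     closure (cspan {blinfun_apply (Q \<phi>) u | \<phi> u. \<phi> \<in> C0}) = UNIV"

definition multiplier_algebra ::
    "(('x::topological_space \<Rightarrow> complex) \<Rightarrow> ('h::complex_banach \<Rightarrow>\<^sub>L 'h)) \<Rightarrow> ('h \<Rightarrow>\<^sub>L 'h) set" where
  "multiplier_algebra Q = closure (Q ` C0)"

definition B0_left ::
    "(('x::topological_space \<Rightarrow> complex) \<Rightarrow> ('k::complex_banach \<Rightarrow>\<^sub>L 'k)) \<Rightarrow>
     ('h::complex_banach \<Rightarrow>\<^sub>L 'k) set" where
  "B0_left QK = closure (cspan {N o\<^sub>L T | N T. N \<in> multiplier_algebra QK \<and> T \<in> bounded_ops})"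

definition B0_right ::
    "(('x::topological_space \<Rightarrow> complex) \<Rightarrow> ('h::complex_banach \<Rightarrow>\<^sub>L 'h)) \<Rightarrow>
     ('h \<Rightarrow>\<^sub>L 'k::complex_banach) set" where
  "B0_right QH = closure (cspan {T o\<^sub>L M | T M. T \<in> bounded_ops \<and> M \<in> multiplier_algebra QH})"

definition decay_preserving ::
    "(('x::topological_space \<Rightarrow> complex) \<Rightarrow> ('h::complex_banach \<Rightarrow>\<^sub>L 'h)) \<Rightarrow>
     (('x \<Rightarrow> complex) \<Rightarrow> ('k::complex_banach \<Rightarrow>\<^sub>L 'k)) \<Rightarrow> ('h \<Rightarrow>\<^sub>L 'k) \<Rightarrow> bool" where
  "decay_preserving QH QK S \<longleftrightarrow>
     (\<forall>M\<in>multiplier_algebra QH. S o\<^sub>L M \<in> B0_left QK) \<and>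
     (\<forall>N\<in>multiplier_algebra QK. N o\<^sub>L S \<in> B0_right QH)"

definition commutator_bounded ::
    "(('x::topological_space \<Rightarrow> complex) \<Rightarrow> ('h::complex_banach \<Rightarrow>\<^sub>L 'h)) \<Rightarrow>
     (('x \<Rightarrow> complex) \<Rightarrow> ('k::complex_banach \<Rightarrow>\<^sub>L 'k)) \<Rightarrow>
     ('h \<Rightarrow>\<^sub>L 'k) \<Rightarrow> ('x \<Rightarrow> complex) \<Rightarrow> bool" where
  "commutator_bounded QH QK S \<theta> \<longleftrightarrow>
     (\<exists>C. \<forall>\<xi>\<in>Cc. \<forall>\<eta>\<in>Cc.
        norm ((QK \<xi> o\<^sub>L S o\<^sub>L QH (\<lambda>x. \<theta> x * \<eta> x)) - (QK (\<lambda>x. \<xi> x * \<theta> x) o\<^sub>L S o\<^sub>L QH \<eta>))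
          \<le> C * (SUP x. cmod (\<xi> x)) * (SUP x. cmod (\<eta> x)))"

end

(* Let e\<^sub>n be the cutoff that is 1 on the ball of radius n about a base point and 0 outside the ball of
   radius n + 1, and let \<theta> = 1 + dist(x0, -). For m \<ge> n put \<xi> = (e\<^sub>m - e\<^sub>n) / \<theta>, so that |\<xi>| \<le> 1 / (n + 1)
   and \<xi> \<theta> = e\<^sub>m - e\<^sub>n. For compactly supported \<eta> the bound on [S, \<theta>(Q)] then gives
   |(e\<^sub>m - e\<^sub>n)(Q) S \<eta>(Q)| \<le> |\<xi>(Q) S (\<theta> \<eta>)(Q)| + C sup|\<xi>| sup|\<eta>| = O(1 / n), uniformly in m.
   As e\<^sub>m(Q) tends strongly to the identity, e\<^sub>n(Q) S \<eta>(Q) tends in norm to S \<eta>(Q).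
   The other half of decay preservation is symmetric. *)

theory Submission
  imports Defs
begin

section \<open>Functions of compact support and functions vanishing at infinity\<close>

lemma C0_continuous_on: "\<phi> \<in> C0 \<Longrightarrow> continuous_on UNIV \<phi>"
  by (simp add: C0_def)

text \<open>In a Hausdorff space \<open>K\<close> is closed, so it contains the closed support,
  which is then a closed subset of a compact set. Membership thus reduces to exhibiting some compact
  set off which \<open>f\<close> vanishes.\<close>

lemma CcI:
  fixes f :: "'x::t2_space \<Rightarrow> complex"
  assumes "continuous_on UNIV f" "compact K" "\<And>x. x \<notin> K \<Longrightarrow> f x = 0"
  shows "f \<in> Cc"
proof -
  have "closure {x. f x \<noteq> 0} \<subseteq> K"
    using assms(2,3) by (intro closure_minimal compact_imp_closed) auto
  then have "closure {x. f x \<noteq> 0} = K \<inter> closure {x. f x \<noteq> 0}" by blast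
  moreover have "compact (K \<inter> closure {x. f x \<noteq> 0})"
    using assms(2) by (rule compact_Int_closed) simp
  ultimately show ?thesis using assms(1) by (simp add: Cc_def)
qed

lemma Cc_vanishes:
  assumes "f \<in> Cc"
  obtains K where "compact K" "\<And>x. x \<notin> K \<Longrightarrow> f x = 0"
proof
  show "compact (closure {x. f x \<noteq> 0})" using assms by (simp add: Cc_def)
  show "f x = 0" if "x \<notin> closure {x. f x \<noteq> 0}" for x
    using that closure_subset[of "{x. f x \<noteq> 0}"] by blast
qed

lemma Cc_imp_C0: "f \<in> Cc \<Longrightarrow> f \<in> C0"
proof -
  assume f: "f \<in> Cc"
  then obtain K where "compact K" "\<And>x. x \<notin> K \<Longrightarrow> f x = 0" by (rule Cc_vanishes) blast
  then have "eventually (\<lambda>x. f x = 0) at_infty" by (auto simp: eventually_at_infty)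
  then have "(f \<longlongrightarrow> 0) at_infty" by (rule tendsto_eventually)
  with f show "f \<in> C0" by (simp add: C0_def Cc_def)
qed

lemma Cc_mult:
  fixes f :: "'x::t2_space \<Rightarrow> complex"
  assumes "f \<in> Cc" "continuous_on UNIV g"
  shows "(\<lambda>x. f x * g x) \<in> Cc" "(\<lambda>x. g x * f x) \<in> Cc"
proof -
  obtain K where "compact K" "\<And>x. x \<notin> K \<Longrightarrow> f x = 0" by (rule Cc_vanishes[OF assms(1)]) blast
  then show "(\<lambda>x. f x * g x) \<in> Cc"
    using assms by (intro CcI[of _ K] continuous_intros) (auto simp: Cc_def)
  then show "(\<lambda>x. g x * f x) \<in> Cc" by (simp add: mult.commute)
qed

lemma C0_diff: "\<phi> \<in> C0 \<Longrightarrow> \<psi> \<in> C0 \<Longrightarrow> (\<lambda>x. \<phi> x - \<psi> x) \<in> C0"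
  unfolding C0_def by (auto intro!: continuous_intros tendsto_eq_intros)

lemma C0_cmult: "\<phi> \<in> C0 \<Longrightarrow> (\<lambda>x. c * \<phi> x) \<in> C0"
  unfolding C0_def by (auto intro!: continuous_intros tendsto_eq_intros)

lemma zero_in_C0: "(\<lambda>_. 0) \<in> C0"
  by (simp add: C0_def)

lemma C0_small_outside_compact:
  assumes "\<phi> \<in> C0" "e > 0"
  obtains K where "compact K" "\<And>x. x \<notin> K \<Longrightarrow> cmod (\<phi> x) < e"
proof -
  have "eventually (\<lambda>x. cmod (\<phi> x) < e) at_infty"
    using assms by (auto simp: C0_def tendsto_iff)
  then show ?thesis using that by (auto simp: eventually_at_infty)
qed

text \<open>Off a compact set the values are below 1 in modulus, and on that set continuity gives a
  bound; the larger of the two works everywhere.\<close>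

lemma C0_bounded:
  assumes "\<phi> \<in> C0"
  obtains r where "r \<ge> 0" "\<And>x. cmod (\<phi> x) \<le> r"
proof -
  obtain K where K: "compact K" "\<And>x. x \<notin> K \<Longrightarrow> cmod (\<phi> x) < 1"
    by (rule C0_small_outside_compact[OF assms, of 1]) auto
  have "compact (\<phi> ` K)"
    using K(1) C0_continuous_on[OF assms] by (intro compact_continuous_image) (auto intro: continuous_on_subset)
  then obtain a where a: "\<And>x. x \<in> K \<Longrightarrow> cmod (\<phi> x) \<le> a"
    using compact_imp_bounded by (force simp: bounded_iff)
  show ?thesis
  proof (rule that[of "max a 1"])
    show "cmod (\<phi> x) \<le> max a 1" for x
      using a[of x] K(2)[of x] by (cases "x \<in> K") auto
  qed simp
qed

section \<open>Algebra and boundedness of the module morphism\<close>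

lemma banach_module_add:
  "banach_module Q \<Longrightarrow> \<phi> \<in> C0 \<Longrightarrow> \<psi> \<in> C0 \<Longrightarrow> Q (\<lambda>x. \<phi> x + \<psi> x) = Q \<phi> + Q \<psi>"
  by (simp add: banach_module_def)

lemma banach_module_diff:
  assumes Q: "banach_module Q" and "\<phi> \<in> C0" "\<psi> \<in> C0"
  shows "Q (\<lambda>x. \<phi> x - \<psi> x) = Q \<phi> - Q \<psi>"
proof -
  have "Q (\<lambda>x. (\<phi> x - \<psi> x) + \<psi> x) = Q (\<lambda>x. \<phi> x - \<psi> x) + Q \<psi>"
    by (rule banach_module_add[OF Q C0_diff[OF assms(2,3)] assms(3)])
  then show ?thesis by simp
qed

lemma banach_module_cmult:
  "banach_module Q \<Longrightarrow> \<phi> \<in> C0 \<Longrightarrow> Q (\<lambda>x. c * \<phi> x) = c *\<^sub>C Q \<phi>"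
  by (simp add: banach_module_def)

lemma banach_module_mult:
  "banach_module Q \<Longrightarrow> \<phi> \<in> C0 \<Longrightarrow> \<psi> \<in> C0 \<Longrightarrow> Q (\<lambda>x. \<phi> x * \<psi> x) = Q \<phi> o\<^sub>L Q \<psi>"
  by (simp add: banach_module_def)

lemma banach_module_bounded_ops: "banach_module Q \<Longrightarrow> \<phi> \<in> C0 \<Longrightarrow> Q \<phi> \<in> bounded_ops"
  by (simp add: banach_module_def)

lemma banach_module_zero: "banach_module Q \<Longrightarrow> Q (\<lambda>_. 0) = 0"
  using banach_module_cmult[of Q "\<lambda>_. 0" 0] zero_in_C0
  by (simp add: complex_vector.scale_zero_left)

text \<open>A linear map continuous at 0 is bounded. The conclusion uses an arbitrary pointwise
  bound \<open>r\<close>, so later estimates need neither suprema nor the type of bounded continuous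
  functions.\<close>

lemma banach_module_bounded:
  fixes Q :: "('x::topological_space \<Rightarrow> complex) \<Rightarrow> ('h::complex_banach \<Rightarrow>\<^sub>L 'h)"
  assumes Q: "banach_module Q"
  obtains B where "B > 0" "\<And>\<phi> r. \<phi> \<in> C0 \<Longrightarrow> (\<And>x. cmod (\<phi> x) \<le> r) \<Longrightarrow> norm (Q \<phi>) \<le> B * r"
proof -
  have z: "apply_bcontfun (0 :: 'x \<Rightarrow>\<^sub>C complex) = (\<lambda>_. 0)" by (simp add: fun_eq_iff)
  have "continuous_on {\<phi> :: 'x \<Rightarrow>\<^sub>C complex. apply_bcontfun \<phi> \<in> C0} (\<lambda>\<phi>. Q (apply_bcontfun \<phi>))"
    using Q by (simp add: banach_module_def)
  moreover have "(0 :: 'x \<Rightarrow>\<^sub>C complex) \<in> {\<phi>. apply_bcontfun \<phi> \<in> C0}"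
    by (simp add: z zero_in_C0)
  ultimately have "\<exists>d>0. \<forall>\<phi>\<in>{\<phi> :: 'x \<Rightarrow>\<^sub>C complex. apply_bcontfun \<phi> \<in> C0}.
      dist \<phi> 0 < d \<longrightarrow> dist (Q (apply_bcontfun \<phi>)) (Q (apply_bcontfun 0)) < 1"
    unfolding continuous_on_iff using zero_less_one by blast
  then obtain d where d: "d > 0"
    "\<And>\<phi> :: 'x \<Rightarrow>\<^sub>C complex. apply_bcontfun \<phi> \<in> C0 \<Longrightarrow> dist \<phi> 0 < d \<Longrightarrow> norm (Q (apply_bcontfun \<phi>)) < 1"
    by (auto simp: z banach_module_zero[OF Q])
  \<comment> \<open>A pointwise bound on \<open>\<phi>\<close> yields only a non-strict bound on the
    distance to 0, so \<open>d / 2\<close> leaves room for the strict \<open>< d\<close> of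
    continuity.\<close>
  have small: "norm (Q \<phi>) \<le> 1" if \<phi>: "\<phi> \<in> C0" "\<And>x. cmod (\<phi> x) \<le> d / 2" for \<phi>
  proof -
    have "bounded (range \<phi>)"
      by (rule boundedI[of _ "d / 2"]) (use \<phi>(2) in blast)
    then have "\<phi> \<in> bcontfun"
      using C0_continuous_on[OF \<phi>(1)] by (simp add: bcontfun_def)
    then have app: "apply_bcontfun (Bcontfun \<phi>) = \<phi>" by (rule Bcontfun_inverse)
    have "dist (Bcontfun \<phi>) 0 \<le> d / 2"
      using \<phi>(2) by (intro dist_bound) (simp add: app)
    then show ?thesis using d(2)[of "Bcontfun \<phi>"] d(1) \<phi>(1) by (simp add: app)
  qed
  show ?thesis
  proof (rule that[of "2 / d"])
    fix \<phi> :: "'x \<Rightarrow> complex" and r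
    assume \<phi>: "\<phi> \<in> C0" "\<And>x. cmod (\<phi> x) \<le> r"
    then have r: "r \<ge> 0" using norm_ge_zero order_trans by blast
    show "norm (Q \<phi>) \<le> 2 / d * r"
    proof (cases "r = 0")
      case True
      then have "\<phi> = (\<lambda>_. 0)" using \<phi>(2) by auto
      then show ?thesis using True banach_module_zero[OF Q] by simp
    next
      case False
      \<comment> \<open>Scaling by \<open>c\<close> turns the bound \<open>r\<close> into
        \<open>d / 2\<close>. The case \<open>r = 0\<close>, where \<open>c\<close> would divide by
        zero, has been settled separately.\<close>
      define c where "c = d / (2 * r)"
      have c: "c > 0" using False r d by (simp add: c_def)
      have "norm (Q (\<lambda>x. complex_of_real c * \<phi> x)) \<le> 1"
      proof (rule small)
        show "cmod (complex_of_real c * \<phi> x) \<le> d / 2" for x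
        proof -
          have "cmod (complex_of_real c * \<phi> x) = c * cmod (\<phi> x)" using c by (simp add: norm_mult)
          also have "\<dots> \<le> c * r" using c \<phi>(2) by (intro mult_left_mono) auto
          also have "\<dots> = d / 2" using False by (simp add: c_def)
          finally show ?thesis .
        qed
      qed (rule C0_cmult[OF \<phi>(1)])
      then have "c * norm (Q \<phi>) \<le> 1"
        using c by (simp add: banach_module_cmult[OF Q \<phi>(1)] norm_scaleC)
      then show ?thesis using False r d by (simp add: c_def field_simps)
    qed
  qed (use d in simp)
qed

section \<open>Composition of bounded operators\<close>

lemma bounded_ops_compose: "S \<in> bounded_ops \<Longrightarrow> T \<in> bounded_ops \<Longrightarrow> S o\<^sub>L T \<in> bounded_ops"
  by (simp add: bounded_ops_def)

lemma blinfun_compose_assoc: "(A o\<^sub>L B) o\<^sub>L C = A o\<^sub>L (B o\<^sub>L C)"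
  by (rule blinfun_eqI) simp

lemma norm_compose3_le:
  fixes R :: "'b::real_normed_vector \<Rightarrow>\<^sub>L 'c::real_normed_vector"
  assumes "norm R \<le> a" "norm T \<le> b"
  shows "norm (R o\<^sub>L S o\<^sub>L T) \<le> a * norm S * b"
proof -
  have a: "0 \<le> a" using norm_ge_zero assms(1) by (rule order_trans)
  have "norm (R o\<^sub>L S o\<^sub>L T) \<le> norm (R o\<^sub>L S) * norm T" by (rule norm_blinfun_compose)
  also have "\<dots> \<le> norm R * norm S * norm T"
    by (intro mult_right_mono norm_blinfun_compose) simp
  also have "\<dots> \<le> a * norm S * b"
    using assms a by (intro mult_mono mult_right_mono mult_nonneg_nonneg) auto
  finally show ?thesis .
qed

section \<open>Cutoffs as an approximate identity\<close>

definition cutoff :: "'x::metric_space \<Rightarrow> nat \<Rightarrow> 'x \<Rightarrow> complex" where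
  "cutoff x0 n x = complex_of_real (max 0 (min 1 (real n + 1 - dist x0 x)))"

lemma cutoff_continuous_on: "continuous_on A (cutoff x0 n)"
  unfolding cutoff_def[abs_def] by (intro continuous_intros)

lemma cutoff_eq_0: "x \<notin> cball x0 (real n + 1) \<Longrightarrow> cutoff x0 n x = 0"
  by (simp add: cutoff_def)

lemma cutoff_eq_1: "x \<in> cball x0 (real n) \<Longrightarrow> cutoff x0 n x = 1"
  by (simp add: cutoff_def)

lemma norm_cutoff_le: "cmod (cutoff x0 n x) \<le> 1"
  by (simp add: cutoff_def)

lemma norm_1_diff_cutoff_le: "cmod (cutoff x0 n x - 1) \<le> 1"
proof -
  have "cutoff x0 n x - 1 = complex_of_real (max 0 (min 1 (real n + 1 - dist x0 x)) - 1)"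
    by (simp add: cutoff_def)
  then show ?thesis by (simp only: norm_of_real)
qed

lemma norm_cutoff_diff_le: "cmod (cutoff x0 m x - cutoff x0 n x) \<le> 1"
proof -
  have "cutoff x0 m x - cutoff x0 n x = complex_of_real
      (max 0 (min 1 (real m + 1 - dist x0 x)) - max 0 (min 1 (real n + 1 - dist x0 x)))"
    by (simp add: cutoff_def)
  then show ?thesis by (simp only: norm_of_real)
qed

lemma cutoff_in_Cc:
  fixes x0 :: "'x::metric_space"
  assumes "proper_metric_space TYPE('x)"
  shows "cutoff x0 n \<in> Cc"
  using assms cutoff_eq_0
  by (intro CcI[of _ "cball x0 (real n + 1)"] cutoff_continuous_on)
     (auto simp: proper_metric_space_iff)

text \<open>The weight is unbounded on its own, but its product with \<open>\<eta>\<close> is again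
  continuous with compact support. The bound \<open>s\<close> enters the constant of the convergence
  rate below.\<close>

lemma Cc_weight_bounded:
  fixes \<eta> :: "'x::metric_space \<Rightarrow> complex"
  assumes "\<eta> \<in> Cc"
  obtains s where "\<And>x. cmod (complex_of_real (1 + dist x0 x) * \<eta> x) \<le> s"
proof -
  have "(\<lambda>x. complex_of_real (1 + dist x0 x) * \<eta> x) \<in> C0"
    by (intro Cc_imp_C0 Cc_mult(2)[OF assms] continuous_intros)
  then show ?thesis using that by (rule C0_bounded)
qed

text \<open>Norm convergence holds because \<open>\<phi>\<close> is uniformly small off a compact
  set, while the cutoffs are eventually 1 on that set; boundedness of \<open>Q\<close> transfers the
  uniform estimate to operators.\<close>

lemma cutoff_mult_tendsto:
  fixes Q :: "('x::metric_space \<Rightarrow> complex) \<Rightarrow> ('h::complex_banach \<Rightarrow>\<^sub>L 'h)"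
  assumes X: "proper_metric_space TYPE('x)" and Q: "banach_module Q" and \<phi>: "\<phi> \<in> C0"
  shows "(\<lambda>n. Q (\<lambda>x. cutoff x0 n x * \<phi> x)) \<longlonglongrightarrow> Q \<phi>"
proof (rule LIMSEQ_I)
  fix e :: real assume e: "e > 0"
  obtain B where B: "B > 0" "\<And>\<phi> r. \<phi> \<in> C0 \<Longrightarrow> (\<And>x. cmod (\<phi> x) \<le> r) \<Longrightarrow> norm (Q \<phi>) \<le> B * r"
    using banach_module_bounded[OF Q] by blast
  obtain K where K: "compact K" "\<And>x. x \<notin> K \<Longrightarrow> cmod (\<phi> x) < e / (2 * B)"
    using C0_small_outside_compact[OF \<phi>, of "e / (2 * B)"] e B(1) by auto
  \<comment> \<open>A compact set lies in some ball about \<open>x0\<close>, so every cutoff of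
    index at least \<open>b\<close> equals 1 on all of \<open>K\<close>.\<close>
  obtain b where b: "\<And>x. x \<in> K \<Longrightarrow> dist x0 x \<le> b"
    using compact_imp_bounded[OF K(1)] bounded_any_center[of K x0] by auto
  obtain N where N: "b \<le> real N" using real_arch_simple by blast
  show "\<exists>no. \<forall>n\<ge>no. norm (Q (\<lambda>x. cutoff x0 n x * \<phi> x) - Q \<phi>) < e"
  proof (intro exI allI impI)
    fix n assume n: "n \<ge> N"
    have c: "(\<lambda>x. cutoff x0 n x * \<phi> x) \<in> C0"
      by (intro Cc_imp_C0 Cc_mult cutoff_in_Cc[OF X] C0_continuous_on[OF \<phi>])
    have "norm (Q (\<lambda>x. cutoff x0 n x * \<phi> x - \<phi> x)) \<le> B * (e / (2 * B))"
    proof (rule B(2))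
      fix x
      show "cmod (cutoff x0 n x * \<phi> x - \<phi> x) \<le> e / (2 * B)"
      proof (cases "x \<in> K")
        case True
        then have "cutoff x0 n x = 1" using b[of x] N n by (intro cutoff_eq_1) auto
        then show ?thesis using e B(1) by simp
      next
        case False
        have "cutoff x0 n x * \<phi> x - \<phi> x = (cutoff x0 n x - 1) * \<phi> x"
          by (simp add: algebra_simps)
        then have "cmod (cutoff x0 n x * \<phi> x - \<phi> x) \<le> cmod (\<phi> x)"
          using mult_right_mono[OF norm_1_diff_cutoff_le[of x0 n x], of "cmod (\<phi> x)"]
          by (simp add: norm_mult)
        then show ?thesis using K(2)[OF False] by linarith
      qed
    qed (rule C0_diff[OF c \<phi>])
    then show "norm (Q (\<lambda>x. cutoff x0 n x * \<phi> x) - Q \<phi>) < e"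
      using e B(1) by (simp add: banach_module_diff[OF Q c \<phi>])
  qed
qed

text \<open>On vectors \<open>Q \<phi> w\<close> this follows from
  \<open>cutoff_mult_tendsto\<close>. Linearity extends it to their span; density and the uniform
  bound \<open>B\<close> on the norms of \<open>Q (cutoff x0 n)\<close> extend it to every
  \<open>u\<close>.\<close>

lemma cutoff_strong_tendsto:
  fixes Q :: "('x::metric_space \<Rightarrow> complex) \<Rightarrow> ('h::complex_banach \<Rightarrow>\<^sub>L 'h)"
  assumes X: "proper_metric_space TYPE('x)" and Q: "banach_module Q"
  shows "(\<lambda>n. blinfun_apply (Q (cutoff x0 n)) u) \<longlonglongrightarrow> u"
proof -
  obtain B where B: "B > 0" "\<And>\<phi> r. \<phi> \<in> C0 \<Longrightarrow> (\<And>x. cmod (\<phi> x) \<le> r) \<Longrightarrow> norm (Q \<phi>) \<le> B * r"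
    using banach_module_bounded[OF Q] by blast
  have c: "cutoff x0 n \<in> C0" for n by (intro Cc_imp_C0 cutoff_in_Cc[OF X])
  have QB: "norm (Q (cutoff x0 n)) \<le> B" for n
    using B(2)[OF c[of n], of 1] norm_cutoff_le by auto
  let ?G = "{blinfun_apply (Q \<phi>) u | \<phi> u. \<phi> \<in> C0}"
  have span: "(\<lambda>n. blinfun_apply (Q (cutoff x0 n)) v) \<longlonglongrightarrow> v" if "v \<in> cspan ?G" for v
    using that
  proof (induction rule: complex_vector.span_induct_alt)
    case base
    show ?case by simp
  next
    case (step a x y)
    then obtain \<phi> w where x: "x = blinfun_apply (Q \<phi>) w" and \<phi>: "\<phi> \<in> C0" by blast
    \<comment> \<open>The scalar is absorbed into \<open>w\<close>, so that only complex linearity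
      of \<open>Q \<phi>\<close> is called upon.\<close>
    have "(\<lambda>n. blinfun_apply (Q (\<lambda>x. cutoff x0 n x * \<phi> x)) (a *\<^sub>C w)) \<longlonglongrightarrow> blinfun_apply (Q \<phi>) (a *\<^sub>C w)"
      by (intro blinfun.tendsto cutoff_mult_tendsto[OF X Q \<phi>] tendsto_const)
    moreover have "a *\<^sub>C x = blinfun_apply (Q \<phi>) (a *\<^sub>C w)"
      using banach_module_bounded_ops[OF Q \<phi>] by (simp add: x bounded_ops_def)
    ultimately have "(\<lambda>n. blinfun_apply (Q (cutoff x0 n)) (a *\<^sub>C x)) \<longlonglongrightarrow> a *\<^sub>C x"
      by (simp add: banach_module_mult[OF Q c \<phi>])
    from tendsto_add[OF this step.IH] show ?case by (simp add: blinfun.add_right)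
  qed
  have dense: "u \<in> closure (cspan ?G)" using Q by (simp add: banach_module_def)
  show ?thesis
  proof (rule LIMSEQ_I)
    fix e :: real assume e: "e > 0"
    \<comment> \<open>Replacing \<open>u\<close> by \<open>v\<close> costs at most
      \<open>(B + 1) * norm (u - v)\<close>: a factor \<open>B\<close> under the operator and 1
      outside it. This leaves \<open>e / 2\<close> for the convergence at \<open>v\<close>.\<close>
    have "e / (2 * (B + 1)) > 0" using e B(1) by simp
    then obtain v where v: "v \<in> cspan ?G" "dist u v < e / (2 * (B + 1))"
      using closure_approachableD[OF dense] by blast
    obtain N where N: "\<And>n. n \<ge> N \<Longrightarrow> norm (blinfun_apply (Q (cutoff x0 n)) v - v) < e / 2"
      using LIMSEQ_D[OF span[OF v(1)], of "e / 2"] e by auto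
    show "\<exists>no. \<forall>n\<ge>no. norm (blinfun_apply (Q (cutoff x0 n)) u - u) < e"
    proof (intro exI allI impI)
      fix n assume n: "n \<ge> N"
      let ?T = "blinfun_apply (Q (cutoff x0 n))"
      have eq: "?T u - u = ?T (u - v) + (?T v - v) + (v - u)" by (simp add: blinfun.diff_right)
      have "norm (?T (u - v)) \<le> B * norm (u - v)"
        using norm_blinfun[of "Q (cutoff x0 n)" "u - v"] mult_right_mono[OF QB[of n] norm_ge_zero[of "u - v"]]
        by linarith
      moreover have "(B + 1) * norm (u - v) \<le> e / 2"
        using v(2) B(1) by (simp add: dist_norm field_simps)
      moreover have "norm (?T u - u) \<le> norm (?T (u - v)) + norm (?T v - v) + norm (u - v)"
        unfolding eq using norm_triangle_ineq[of "?T (u - v) + (?T v - v)" "v - u"]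
          norm_triangle_ineq[of "?T (u - v)" "?T v - v"] norm_minus_commute[of u v] by linarith
      ultimately show "norm (?T u - u) < e" using N[OF n] by (simp add: algebra_simps)
    qed
  qed
qed

section \<open>From strong convergence to norm convergence\<close>

text \<open>For fixed \<open>n\<close>, the rate is applied to each vector and \<open>m\<close> is
  sent to infinity: the strong limit inherits the bound on its distance from \<open>A n\<close>. The
  index \<open>Suc n\<close> keeps the denominator nonzero at \<open>n = 0\<close>.\<close>

lemma strong_limit_rate_imp_tendsto:
  fixes A :: "nat \<Rightarrow> 'a::real_normed_vector \<Rightarrow>\<^sub>L 'b::real_normed_vector"
  assumes rate: "\<And>m n. n \<le> m \<Longrightarrow> norm (A m - A n) \<le> c / real (Suc n)"
    and strong: "\<And>u. (\<lambda>n. blinfun_apply (A n) u) \<longlonglongrightarrow> blinfun_apply L u"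
  shows "A \<longlonglongrightarrow> L"
proof -
  have c: "c \<ge> 0" using rate[of 0 0] by simp
  have "norm (A n - L) \<le> c / real (Suc n)" for n
  proof -
    have "norm (L - A n) \<le> c / real (Suc n)"
    proof (rule norm_blinfun_bound)
      fix u
      have "(\<lambda>m. norm (blinfun_apply (A m - A n) u)) \<longlonglongrightarrow> norm (blinfun_apply (L - A n) u)"
        unfolding blinfun.diff_left by (intro tendsto_norm tendsto_diff strong tendsto_const)
      moreover have "norm (blinfun_apply (A m - A n) u) \<le> c / real (Suc n) * norm u" if "n \<le> m" for m
        using norm_blinfun[of "A m - A n" u] mult_right_mono[OF rate[OF that], of "norm u"] by simp
      ultimately show "norm (blinfun_apply (L - A n) u) \<le> c / real (Suc n) * norm u"
        by (intro Lim_bounded[where M = n]) auto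
    qed (use c in simp)
    then show ?thesis by (simp add: norm_minus_commute)
  qed
  moreover have "(\<lambda>n. c / real (Suc n)) \<longlonglongrightarrow> 0"
    using tendsto_mult_right_zero[OF LIMSEQ_inverse_real_of_nat, of c] by (simp add: divide_inverse)
  ultimately have "(\<lambda>n. A n - L) \<longlonglongrightarrow> 0"
    by (intro Lim_null_comparison[of "\<lambda>n. A n - L"]) auto
  then show ?thesis by (rule LIM_zero_cancel)
qed

section \<open>Test functions for the commutator estimate\<close>

text \<open>Since \<open>n \<le> m\<close>, both cutoffs are 1 on the ball of radius
  \<open>n\<close>, so the numerator vanishes there; elsewhere the weight exceeds
  \<open>n + 1\<close>. Both cutoffs vanish off the ball of radius \<open>m + 1\<close>, which makes
  the quotient an admissible test function.\<close>

lemma cutoff_quotient: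
  fixes x0 :: "'x::metric_space"
  assumes X: "proper_metric_space TYPE('x)" and mn: "n \<le> m"
  obtains \<xi> where "\<xi> \<in> Cc" "\<And>x. cmod (\<xi> x) \<le> 1 / real (Suc n)"
    "\<And>x. \<xi> x * complex_of_real (1 + dist x0 x) = cutoff x0 m x - cutoff x0 n x"
proof
  let ?\<xi> = "\<lambda>x. (cutoff x0 m x - cutoff x0 n x) / complex_of_real (1 + dist x0 x)"
  have nz: "complex_of_real (1 + dist x0 x) \<noteq> 0" for x
    using zero_le_dist[of x0 x] unfolding of_real_eq_0_iff by linarith
  show "?\<xi> x * complex_of_real (1 + dist x0 x) = cutoff x0 m x - cutoff x0 n x" for x
    using nz by simp
  show "?\<xi> \<in> Cc"
  proof (rule CcI)
    show "continuous_on UNIV ?\<xi>"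
      using nz by (intro continuous_intros cutoff_continuous_on) auto
    show "compact (cball x0 (real m + 1))" using X by (auto simp: proper_metric_space_iff)
    show "?\<xi> x = 0" if "x \<notin> cball x0 (real m + 1)" for x
      using that mn by (simp add: cutoff_eq_0)
  qed
  show "cmod (?\<xi> x) \<le> 1 / real (Suc n)" for x
  proof (cases "dist x0 x \<le> real n")
    case True
    then show ?thesis using mn by (simp add: cutoff_eq_1)
  next
    case False
    have "cmod (?\<xi> x) = cmod (cutoff x0 m x - cutoff x0 n x) / (1 + dist x0 x)"
      by (simp only: norm_divide norm_of_real) simp
    also have "\<dots> \<le> 1 / real (Suc n)"
      using False norm_cutoff_diff_le[of x0 m x n] by (intro frac_le) auto
    finally show ?thesis .
  qed
qed

text \<open>Pointwise bounds replace the suprema, in the form in which estimates on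
  \<open>\<xi>\<close> and \<open>\<eta>\<close> become available later.\<close>

lemma commutator_bounded_sup_bounds:
  fixes \<theta> :: "'x::topological_space \<Rightarrow> complex"
  assumes "commutator_bounded QH QK S \<theta>"
  shows "\<exists>C. \<forall>\<xi>\<in>Cc. \<forall>\<eta>\<in>Cc. \<forall>a b. (\<forall>x. cmod (\<xi> x) \<le> a) \<longrightarrow> (\<forall>x. cmod (\<eta> x) \<le> b) \<longrightarrow>
     norm ((QK \<xi> o\<^sub>L S o\<^sub>L QH (\<lambda>x. \<theta> x * \<eta> x)) - (QK (\<lambda>x. \<xi> x * \<theta> x) o\<^sub>L S o\<^sub>L QH \<eta>)) \<le> C * a * b"
proof -
  obtain C where C: "\<And>\<xi> \<eta>. \<xi> \<in> Cc \<Longrightarrow> \<eta> \<in> Cc \<Longrightarrow>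
     norm ((QK \<xi> o\<^sub>L S o\<^sub>L QH (\<lambda>x. \<theta> x * \<eta> x)) - (QK (\<lambda>x. \<xi> x * \<theta> x) o\<^sub>L S o\<^sub>L QH \<eta>))
          \<le> C * (SUP x. cmod (\<xi> x)) * (SUP x. cmod (\<eta> x))"
    using assms unfolding commutator_bounded_def by blast
  show ?thesis
  \<comment> \<open>The given constant may be negative, and then enlarging the suprema would reverse
    the inequality; the absolute value avoids this.\<close>
  proof (intro exI[of _ "\<bar>C\<bar>"] ballI allI impI)
    fix \<xi> \<eta> :: "'x \<Rightarrow> complex" and a b
    assume in_Cc: "\<xi> \<in> Cc" "\<eta> \<in> Cc" and "\<forall>x. cmod (\<xi> x) \<le> a" "\<forall>x. cmod (\<eta> x) \<le> b"
    then have ab: "\<bar>SUP x. cmod (\<xi> x)\<bar> \<le> a" "\<bar>SUP x. cmod (\<eta> x)\<bar> \<le> b"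
      by (auto intro!: cSup_abs_le)
    have "C * (SUP x. cmod (\<xi> x)) * (SUP x. cmod (\<eta> x))
        \<le> \<bar>C\<bar> * \<bar>SUP x. cmod (\<xi> x)\<bar> * \<bar>SUP x. cmod (\<eta> x)\<bar>"
      by (metis abs_ge_self abs_mult)
    also have "\<dots> \<le> \<bar>C\<bar> * a * b"
      using ab order_trans[OF abs_ge_zero ab(1)] by (intro mult_mono mult_nonneg_nonneg) auto
    finally show "norm ((QK \<xi> o\<^sub>L S o\<^sub>L QH (\<lambda>x. \<theta> x * \<eta> x)) - (QK (\<lambda>x. \<xi> x * \<theta> x) o\<^sub>L S o\<^sub>L QH \<eta>))
        \<le> \<bar>C\<bar> * a * b"
      using C[OF in_Cc] by linarith
  qed
qed

section \<open>Norm convergence of the truncated operators\<close>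

lemma cutoff_left_tendsto:
  fixes QH :: "('x::metric_space \<Rightarrow> complex) \<Rightarrow> ('h::complex_banach \<Rightarrow>\<^sub>L 'h)"
    and QK :: "('x \<Rightarrow> complex) \<Rightarrow> ('k::complex_banach \<Rightarrow>\<^sub>L 'k)"
  assumes X: "proper_metric_space TYPE('x)" and QH: "banach_module QH" and QK: "banach_module QK"
    and comm: "commutator_bounded QH QK S (\<lambda>x. complex_of_real (1 + dist x0 x))"
    and \<eta>: "\<eta> \<in> Cc"
  shows "(\<lambda>n. QK (cutoff x0 n) o\<^sub>L S o\<^sub>L QH \<eta>) \<longlonglongrightarrow> (S o\<^sub>L QH \<eta>)"
proof -
  let ?\<theta> = "\<lambda>x. complex_of_real (1 + dist x0 x)"
  obtain BH where BH: "\<And>\<phi> r. \<phi> \<in> C0 \<Longrightarrow> (\<And>x. cmod (\<phi> x) \<le> r) \<Longrightarrow> norm (QH \<phi>) \<le> BH * r"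
    using banach_module_bounded[OF QH] by blast
  obtain BK where BK: "\<And>\<phi> r. \<phi> \<in> C0 \<Longrightarrow> (\<And>x. cmod (\<phi> x) \<le> r) \<Longrightarrow> norm (QK \<phi>) \<le> BK * r"
    using banach_module_bounded[OF QK] by blast
  obtain C where C: "\<forall>\<xi>\<in>Cc. \<forall>\<eta>\<in>Cc. \<forall>a b. (\<forall>x. cmod (\<xi> x) \<le> a) \<longrightarrow> (\<forall>x. cmod (\<eta> x) \<le> b) \<longrightarrow>
     norm ((QK \<xi> o\<^sub>L S o\<^sub>L QH (\<lambda>x. ?\<theta> x * \<eta> x)) - (QK (\<lambda>x. \<xi> x * ?\<theta> x) o\<^sub>L S o\<^sub>L QH \<eta>)) \<le> C * a * b"
    using commutator_bounded_sup_bounds[OF comm] ..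
  obtain r where r: "\<And>x. cmod (\<eta> x) \<le> r"
    using C0_bounded[OF Cc_imp_C0[OF \<eta>]] by blast
  obtain s where s: "\<And>x. cmod (?\<theta> x * \<eta> x) \<le> s"
    using Cc_weight_bounded[OF \<eta>] by blast
  have \<theta>\<eta>: "(\<lambda>x. ?\<theta> x * \<eta> x) \<in> C0"
    by (intro Cc_imp_C0 Cc_mult(2)[OF \<eta>] continuous_intros)
  have c: "cutoff x0 n \<in> C0" for n by (intro Cc_imp_C0 cutoff_in_Cc[OF X])
  show ?thesis
  proof (rule strong_limit_rate_imp_tendsto)
    fix m n :: nat assume "n \<le> m"
    then obtain \<xi> where \<xi>: "\<xi> \<in> Cc" "\<And>x. cmod (\<xi> x) \<le> 1 / real (Suc n)"
      "\<And>x. \<xi> x * ?\<theta> x = cutoff x0 m x - cutoff x0 n x"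
      using cutoff_quotient[OF X] by blast
    \<comment> \<open>The difference of two truncations is exactly one of the two terms of the
      commutator for \<open>\<xi>\<close> and \<open>\<eta>\<close>.\<close>
    have eq: "(QK (cutoff x0 m) o\<^sub>L S o\<^sub>L QH \<eta>) - (QK (cutoff x0 n) o\<^sub>L S o\<^sub>L QH \<eta>)
        = QK (\<lambda>x. \<xi> x * ?\<theta> x) o\<^sub>L S o\<^sub>L QH \<eta>" (is "_ = ?D")
      unfolding \<xi>(3) banach_module_diff[OF QK c c]
      by (rule blinfun_eqI) (simp add: blinfun.diff_left)
    \<comment> \<open>In the other term the weight has passed from \<open>\<xi>\<close> to
      \<open>\<eta>\<close>. Now \<open>\<xi>\<close> contributes \<open>1 / real (Suc n)\<close>,
      and the weighted \<open>\<eta>\<close> is bounded by \<open>s\<close>, independently of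
      \<open>m\<close> and \<open>n\<close>.\<close>
    let ?P = "QK \<xi> o\<^sub>L S o\<^sub>L QH (\<lambda>x. ?\<theta> x * \<eta> x)"
    have "norm ?P \<le> (BK * (1 / real (Suc n))) * norm S * (BH * s)"
      by (intro norm_compose3_le BK BH \<theta>\<eta> s \<xi>(2) Cc_imp_C0[OF \<xi>(1)])
    moreover have "norm (?P - ?D) \<le> C * (1 / real (Suc n)) * r"
      by (rule C[rule_format, OF \<xi>(1) \<eta> \<xi>(2) r])
    moreover have "norm ?D \<le> norm ?P + norm (?P - ?D)"
      using norm_triangle_sub[of ?D ?P] by (simp add: norm_minus_commute)
    ultimately have "norm ?D \<le> (BK * norm S * BH * s + C * r) / real (Suc n)"
      by (simp add: add_divide_distrib mult_ac)
    then show "norm ((QK (cutoff x0 m) o\<^sub>L S o\<^sub>L QH \<eta>) - (QK (cutoff x0 n) o\<^sub>L S o\<^sub>L QH \<eta>))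
        \<le> (BK * norm S * BH * s + C * r) / real (Suc n)" unfolding eq .
  next
    show "(\<lambda>n. blinfun_apply (QK (cutoff x0 n) o\<^sub>L S o\<^sub>L QH \<eta>) u) \<longlonglongrightarrow> blinfun_apply (S o\<^sub>L QH \<eta>) u" for u
      by (simp add: cutoff_strong_tendsto[OF X QK])
  qed
qed

text \<open>The mirror image of \<open>cutoff_left_tendsto\<close>: \<open>\<eta>\<close> takes the
  left slot of the commutator, the quotient \<open>\<xi>\<close> the right one, and the weight
  passes from right to left.\<close>

lemma cutoff_right_tendsto:
  fixes QH :: "('x::metric_space \<Rightarrow> complex) \<Rightarrow> ('h::complex_banach \<Rightarrow>\<^sub>L 'h)"
    and QK :: "('x \<Rightarrow> complex) \<Rightarrow> ('k::complex_banach \<Rightarrow>\<^sub>L 'k)"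
  assumes X: "proper_metric_space TYPE('x)" and QH: "banach_module QH" and QK: "banach_module QK"
    and comm: "commutator_bounded QH QK S (\<lambda>x. complex_of_real (1 + dist x0 x))"
    and \<eta>: "\<eta> \<in> Cc"
  shows "(\<lambda>n. QK \<eta> o\<^sub>L S o\<^sub>L QH (cutoff x0 n)) \<longlonglongrightarrow> (QK \<eta> o\<^sub>L S)"
proof -
  let ?\<theta> = "\<lambda>x. complex_of_real (1 + dist x0 x)"
  obtain BH where BH: "\<And>\<phi> r. \<phi> \<in> C0 \<Longrightarrow> (\<And>x. cmod (\<phi> x) \<le> r) \<Longrightarrow> norm (QH \<phi>) \<le> BH * r"
    using banach_module_bounded[OF QH] by blast
  obtain BK where BK: "\<And>\<phi> r. \<phi> \<in> C0 \<Longrightarrow> (\<And>x. cmod (\<phi> x) \<le> r) \<Longrightarrow> norm (QK \<phi>) \<le> BK * r"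
    using banach_module_bounded[OF QK] by blast
  obtain C where C: "\<forall>\<xi>\<in>Cc. \<forall>\<eta>\<in>Cc. \<forall>a b. (\<forall>x. cmod (\<xi> x) \<le> a) \<longrightarrow> (\<forall>x. cmod (\<eta> x) \<le> b) \<longrightarrow>
     norm ((QK \<xi> o\<^sub>L S o\<^sub>L QH (\<lambda>x. ?\<theta> x * \<eta> x)) - (QK (\<lambda>x. \<xi> x * ?\<theta> x) o\<^sub>L S o\<^sub>L QH \<eta>)) \<le> C * a * b"
    using commutator_bounded_sup_bounds[OF comm] ..
  obtain r where r: "\<And>x. cmod (\<eta> x) \<le> r"
    using C0_bounded[OF Cc_imp_C0[OF \<eta>]] by blast
  obtain s where s: "\<And>x. cmod (\<eta> x * ?\<theta> x) \<le> s"
    using Cc_weight_bounded[OF \<eta>] by (metis mult.commute)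
  have \<theta>\<eta>: "(\<lambda>x. \<eta> x * ?\<theta> x) \<in> C0"
    by (intro Cc_imp_C0 Cc_mult(1)[OF \<eta>] continuous_intros)
  have c: "cutoff x0 n \<in> C0" for n by (intro Cc_imp_C0 cutoff_in_Cc[OF X])
  show ?thesis
  proof (rule strong_limit_rate_imp_tendsto)
    fix m n :: nat assume "n \<le> m"
    then obtain \<xi> where \<xi>: "\<xi> \<in> Cc" "\<And>x. cmod (\<xi> x) \<le> 1 / real (Suc n)"
      "\<And>x. \<xi> x * ?\<theta> x = cutoff x0 m x - cutoff x0 n x"
      using cutoff_quotient[OF X] by blast
    have \<xi>': "?\<theta> x * \<xi> x = cutoff x0 m x - cutoff x0 n x" for x
      using \<xi>(3)[of x] by (simp add: mult.commute)
    have eq: "(QK \<eta> o\<^sub>L S o\<^sub>L QH (cutoff x0 m)) - (QK \<eta> o\<^sub>L S o\<^sub>L QH (cutoff x0 n))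
        = QK \<eta> o\<^sub>L S o\<^sub>L QH (\<lambda>x. ?\<theta> x * \<xi> x)" (is "_ = ?D")
      unfolding \<xi>' banach_module_diff[OF QH c c]
      by (rule blinfun_eqI) (simp add: blinfun.diff_left blinfun.diff_right)
    let ?P = "QK (\<lambda>x. \<eta> x * ?\<theta> x) o\<^sub>L S o\<^sub>L QH \<xi>"
    have "norm ?P \<le> (BK * s) * norm S * (BH * (1 / real (Suc n)))"
      by (intro norm_compose3_le BK BH \<theta>\<eta> s \<xi>(2) Cc_imp_C0[OF \<xi>(1)])
    moreover have "norm (?D - ?P) \<le> C * r * (1 / real (Suc n))"
      by (rule C[rule_format, OF \<eta> \<xi>(1) r \<xi>(2)])
    moreover have "norm ?D \<le> norm ?P + norm (?D - ?P)"
      by (rule norm_triangle_sub)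
    ultimately have "norm ?D \<le> (BK * norm S * BH * s + C * r) / real (Suc n)"
      by (simp add: add_divide_distrib mult_ac)
    then show "norm ((QK \<eta> o\<^sub>L S o\<^sub>L QH (cutoff x0 m)) - (QK \<eta> o\<^sub>L S o\<^sub>L QH (cutoff x0 n)))
        \<le> (BK * norm S * BH * s + C * r) / real (Suc n)" unfolding eq .
  next
    show "(\<lambda>n. blinfun_apply (QK \<eta> o\<^sub>L S o\<^sub>L QH (cutoff x0 n)) u) \<longlonglongrightarrow> blinfun_apply (QK \<eta> o\<^sub>L S) u" for u
      \<comment> \<open>Here the cutoffs act first, on \<open>u\<close> itself, so strong
        convergence is carried through the fixed bounded operators \<open>S\<close> and
        \<open>QK \<eta>\<close>.\<close>
      unfolding blinfun_apply_blinfun_compose comp_def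
      by (intro blinfun.tendsto cutoff_strong_tendsto[OF X QH] tendsto_const)
  qed
qed

section \<open>Passage to the multiplier algebra and decay preservation\<close>

text \<open>Each \<open>Q \<phi>\<close> with \<open>\<phi>\<close> in \<open>C0\<close> is the norm
  limit of operators given by the compactly supported products of \<open>\<phi>\<close> with
  cutoffs, so a closed condition need only be tested on \<open>Cc\<close>.\<close>

lemma multiplier_algebra_subset:
  fixes Q :: "('x::metric_space \<Rightarrow> complex) \<Rightarrow> ('h::complex_banach \<Rightarrow>\<^sub>L 'h)"
  assumes X: "proper_metric_space TYPE('x)" and Q: "banach_module Q"
    and A: "closed A" "\<And>\<eta>. \<eta> \<in> Cc \<Longrightarrow> Q \<eta> \<in> A"
  shows "multiplier_algebra Q \<subseteq> A"
proof -
  have "Q \<phi> \<in> A" if \<phi>: "\<phi> \<in> C0" for \<phi>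
  proof (rule closed_sequentially[OF A(1)])
    \<comment> \<open>Any base point serves here; \<open>undefined\<close> merely names one.\<close>
    show "Q (\<lambda>x. cutoff undefined n x * \<phi> x) \<in> A" for n
      by (intro A(2) Cc_mult(1) cutoff_in_Cc[OF X] C0_continuous_on[OF \<phi>])
    show "(\<lambda>n. Q (\<lambda>x. cutoff undefined n x * \<phi> x)) \<longlonglongrightarrow> Q \<phi>"
      by (rule cutoff_mult_tendsto[OF X Q \<phi>])
  qed
  then show ?thesis
    unfolding multiplier_algebra_def by (intro closure_minimal A(1)) auto
qed

lemma in_multiplier_algebra: "\<phi> \<in> C0 \<Longrightarrow> Q \<phi> \<in> multiplier_algebra Q"
  unfolding multiplier_algebra_def by (rule subsetD[OF closure_subset]) blast

lemma B0_leftI: "N \<in> multiplier_algebra QK \<Longrightarrow> T \<in> bounded_ops \<Longrightarrow> N o\<^sub>L T \<in> B0_left QK"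
  unfolding B0_left_def
  by (rule subsetD[OF closure_subset], rule complex_vector.span_base) blast

lemma B0_rightI: "T \<in> bounded_ops \<Longrightarrow> M \<in> multiplier_algebra QH \<Longrightarrow> T o\<^sub>L M \<in> B0_right QH"
  unfolding B0_right_def
  by (rule subsetD[OF closure_subset], rule complex_vector.span_base) blast

theorem corollary2p21:
  fixes QH :: "('x::metric_space \<Rightarrow> complex) \<Rightarrow> ('h::complex_banach \<Rightarrow>\<^sub>L 'h)"
    and QK :: "('x \<Rightarrow> complex) \<Rightarrow> ('k::complex_banach \<Rightarrow>\<^sub>L 'k)"
    and S :: "'h \<Rightarrow>\<^sub>L 'k"
  assumes "proper_metric_space TYPE('x)"
    and "banach_module QH"
    and "banach_module QK"
    and "S \<in> bounded_ops"
    and "\<And>\<theta> :: 'x \<Rightarrow> real. (\<forall>x. \<theta> x > 0) \<Longrightarrow> (\<exists>L. L-lipschitz_on UNIV \<theta>) \<Longrightarrow>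
           commutator_bounded QH QK S (\<lambda>x. complex_of_real (\<theta> x))"
  shows "decay_preserving QH QK S"
proof -
  note X = assms(1) and QH = assms(2) and QK = assms(3) and S = assms(4)
  define x0 :: 'x where "x0 = undefined"
  \<comment> \<open>The summand 1 makes the distance function strictly positive at \<open>x0\<close>
    too, so that the commutator hypothesis applies to it.\<close>
  have "1-lipschitz_on UNIV (\<lambda>x. 1 + dist x0 x)"
    proof (rule lipschitz_onI)
    show "dist (1 + dist x0 x) (1 + dist x0 y) \<le> 1 * dist x y" for x y
      using abs_dist_diff_le[of x x0 y] by (simp add: dist_real_def dist_commute)
  qed simp
  moreover have "\<forall>x. 1 + dist x0 x > 0" by (simp add: add_pos_nonneg)
  ultimately have comm: "commutator_bounded QH QK S (\<lambda>x. complex_of_real (1 + dist x0 x))"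
    by (intro assms(5)) blast+
  have c: "cutoff x0 n \<in> C0" for n by (intro Cc_imp_C0 cutoff_in_Cc[OF X])
  have "multiplier_algebra QH \<subseteq> {M. S o\<^sub>L M \<in> B0_left QK}"
  proof (rule multiplier_algebra_subset[OF X QH])
    \<comment> \<open>Composition with \<open>S\<close> is norm continuous, so the preimage of a
      closed space is closed.\<close>
    have "closed ((\<lambda>M. S o\<^sub>L M) -` B0_left QK)"
      by (intro continuous_closed_vimage) (auto simp: B0_left_def intro!: continuous_intros)
    then show "closed {M. S o\<^sub>L M \<in> B0_left QK}" by (simp add: vimage_def)
    fix \<eta> :: "'x \<Rightarrow> complex" assume \<eta>: "\<eta> \<in> Cc"
    have "S o\<^sub>L QH \<eta> \<in> B0_left QK"
    proof (rule closed_sequentially[OF _ _ cutoff_left_tendsto[OF X QH QK comm \<eta>]])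
      show "QK (cutoff x0 n) o\<^sub>L S o\<^sub>L QH \<eta> \<in> B0_left QK" for n
        \<comment> \<open>Rebracketing isolates the multiplier \<open>QK (cutoff x0 n)\<close> on
          the left of a bounded complex-linear operator. In the other half the default bracketing
          already has the required form.\<close>
        unfolding blinfun_compose_assoc
        by (intro B0_leftI in_multiplier_algebra c bounded_ops_compose S
            banach_module_bounded_ops[OF QH] Cc_imp_C0 \<eta>)
    qed (simp add: B0_left_def)
    then show "QH \<eta> \<in> {M. S o\<^sub>L M \<in> B0_left QK}" by simp
  qed
  moreover have "multiplier_algebra QK \<subseteq> {N. N o\<^sub>L S \<in> B0_right QH}"
  proof (rule multiplier_algebra_subset[OF X QK])
    have "closed ((\<lambda>N. N o\<^sub>L S) -` B0_right QH)"
      by (intro continuous_closed_vimage) (auto simp: B0_right_def intro!: continuous_intros)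
    then show "closed {N. N o\<^sub>L S \<in> B0_right QH}" by (simp add: vimage_def)
    fix \<eta> :: "'x \<Rightarrow> complex" assume \<eta>: "\<eta> \<in> Cc"
    have "QK \<eta> o\<^sub>L S \<in> B0_right QH"
    proof (rule closed_sequentially[OF _ _ cutoff_right_tendsto[OF X QH QK comm \<eta>]])
      show "QK \<eta> o\<^sub>L S o\<^sub>L QH (cutoff x0 n) \<in> B0_right QH" for n
        by (intro B0_rightI in_multiplier_algebra c bounded_ops_compose S
            banach_module_bounded_ops[OF QK] Cc_imp_C0 \<eta>)
    qed (simp add: B0_right_def)
    then show "QK \<eta> \<in> {N. N o\<^sub>L S \<in> B0_right QH}" by simp
  qed
  ultimately show ?thesis unfolding decay_preserving_def by blast
qed

end
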